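(* Let $X$ be a Hilbert space and $f : X \to \mathbb{R}$ a functional of class $C^2$. Suppose that: (1) $f$ is bounded below, with $f(x) \ge 0$ for all $x \in X$; (2) $c\in\mathbb{R}$ is such that the sublevel $f^c := \{x \in X : f(x) < c\}$ is nonempty and not simply connected; (3) $f$ satisfies the Palais-Smale condition at level $c_0$ for every $0 \le c_0 < c$. Let $C$ be a connected component of $f^c$ that is not simply connected. Then one of the following situations occurs: (i) $C$ has a continuum of global minimizers; (ii) there exists a critical point $\hat x \in C$ of $f$ (i.e. $\nabla f(\hat x)=0$) that is not a strict local minimizer of $f$.
   Context: A loop in a set $Y\subset X$ is a continuous map $\gamma:[0,1]\to Y$ with $\gamma(0)=\gamma(1)$. It is contractible in $Y$ if there exist $\bar x \in Y$ and a continuous function $h:[0,1]\times[0,1]\to Y$ with $h(0,s)=\gamma(s)$ and $h(1,s)=\bar x$ for all $s\in[0,1]$, and $h(\lambda,0)=h(\lambda,1)$ for all $\lambda\in(0,1)$. A subset $Y \subset X$ is simply connected if every loop in $Y$ is contractible in $Y$ (connectedness is not part of this definition). A sequence $(x_m)_m \subset X$ is a Palais-Smale sequence at level $c_0$ for $f$ if $f(x_m)\to c_0$ and $\nabla f(x_m)\to 0$. The functional $f$ satisfies the Palais-Smale condition at level $c_0$ if every Palais-Smale sequence at level $c_0$ for $f$ has a converging subsequence. A critical point $x_0$ of $f$ is a strict local minimizer if there exists $r_0>0$ such that $\inf_{x\in\partial B_r(x_0)} f(x) > f(x_0)$ for every $0<r<r_0$, where $B_r(x_0)$ is the ball of radius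 $r$ centered at $x_0$. A global minimizer in $C$ is a point $x\in C$ with $f(x)=\inf_C f$; "a continuum" of such points means a compact connected set with more than one point, contained in $C$ and consisting of global minimizers. *)

theory Defs
  imports "HOL-Analysis.Analysis"
begin

definition C2 :: "('a::real_normed_vector \<Rightarrow> real) \<Rightarrow> bool" where
  "C2 f \<longleftrightarrow> (\<exists>(f' :: 'a \<Rightarrow> 'a \<Rightarrow>\<^sub>L real) (f'' :: 'a \<Rightarrow> 'a \<Rightarrow>\<^sub>L 'a \<Rightarrow>\<^sub>L real).
     (\<forall>x. (f has_derivative blinfun_apply (f' x)) (at x)) \<and>
     (\<forall>x. (f' has_derivative blinfun_apply (f'' x)) (at x)) \<and>
     continuous_on UNIV f'')"

(* On a complete space, the Riesz theorem gives a unique such D wherever f is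
   Frechet differentiable; elsewhere the value is unspecified. *)
definition grad :: "('a::real_inner \<Rightarrow> real) \<Rightarrow> 'a \<Rightarrow> 'a" where
  "grad f x = (THE D. GDERIV f x :> D)"

definition critical_point :: "('a::real_inner \<Rightarrow> real) \<Rightarrow> 'a \<Rightarrow> bool" where
  "critical_point f x \<longleftrightarrow> grad f x = 0"

definition loop_in :: "'a::topological_space set \<Rightarrow> (real \<Rightarrow> 'a) \<Rightarrow> bool" where
  "loop_in Y \<gamma> \<longleftrightarrow> path \<gamma> \<and> path_image \<gamma> \<subseteq> Y \<and> pathstart \<gamma> = pathfinish \<gamma>"

definition contractible_loop :: "'a::topological_space set \<Rightarrow> (real \<Rightarrow> 'a) \<Rightarrow> bool" where
  "contractible_loop Y \<gamma> \<longleftrightarrow> (\<exists>z\<in>Y. \<exists>h :: real \<times> real \<Rightarrow> 'a.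
     continuous_on ({0..1} \<times> {0..1}) h \<and> h ` ({0..1} \<times> {0..1}) \<subseteq> Y \<and>
     (\<forall>s\<in>{0..1}. h (0, s) = \<gamma> s \<and> h (1, s) = z) \<and>
     (\<forall>l\<in>{0<..<1}. h (l, 0) = h (l, 1)))"

lemma contractible_loop_iff:
  fixes Y :: "'a::real_normed_vector set"
  assumes "loop_in Y \<gamma>"
  shows "contractible_loop Y \<gamma> \<longleftrightarrow> (\<exists>z\<in>Y. homotopic_loops Y \<gamma> (linepath z z))"
proof -
  have e: "\<gamma> 0 = \<gamma> 1"
    using assms by (simp add: loop_in_def pathstart_def pathfinish_def)
  have b: "h (l, 1) = h (l, 0)"
    if t: "\<forall>s\<in>{0..1}. h (0, s) = \<gamma> s \<and> h (1, s) = z" "\<forall>l\<in>{0<..<1}. h (l, 0) = h (l, 1)"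
      "0 \<le> l" "l \<le> 1" for h :: "real \<times> real \<Rightarrow> 'a" and z l
  proof -
    consider "l = 0" | "l = 1" | "l \<in> {0<..<1}" using t by force
    then show ?thesis using t e by cases auto
  qed
  show ?thesis
    unfolding contractible_loop_def homotopic_loops
    apply (rule bex_cong[OF refl], rule ex_cong1)
    apply (auto simp: pathstart_def pathfinish_def linepath_refl)
    apply (rule b; auto)
    done
qed

(* Unlike the library's simply_connected, this does not require Y to be path-connected. *)
definition loops_contractible :: "'a::topological_space set \<Rightarrow> bool" where
  "loops_contractible Y \<longleftrightarrow> (\<forall>\<gamma>. loop_in Y \<gamma> \<longrightarrow> contractible_loop Y \<gamma>)"

definition PS_sequence :: "('a::real_inner \<Rightarrow> real) \<Rightarrow> real \<Rightarrow> (nat \<Rightarrow> 'a) \<Rightarrow> bool" where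
  "PS_sequence f c0 x \<longleftrightarrow>
     (\<lambda>m. f (x m)) \<longlonglongrightarrow> c0 \<and> (\<lambda>m. grad f (x m)) \<longlonglongrightarrow> 0"

definition PS_condition :: "('a::real_inner \<Rightarrow> real) \<Rightarrow> real \<Rightarrow> bool" where
  "PS_condition f c0 \<longleftrightarrow>
     (\<forall>x. PS_sequence f c0 x \<longrightarrow> (\<exists>r :: nat \<Rightarrow> nat. strict_mono r \<and> convergent (x \<circ> r)))"

(* Infima are taken in ereal, so that they have their usual meaning also for
   functions unbounded below and for the empty set. *)
definition strict_local_minimizer :: "('a::real_inner \<Rightarrow> real) \<Rightarrow> 'a \<Rightarrow> bool" where
  "strict_local_minimizer f x0 \<longleftrightarrow> critical_point f x0 \<and>
     (\<exists>r0>0. \<forall>r. 0 < r \<and> r < r0 \<longrightarrow>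
        (INF x\<in>frontier (ball x0 r). ereal (f x)) > ereal (f x0))"

definition global_minimizer_in :: "('a \<Rightarrow> real) \<Rightarrow> 'a set \<Rightarrow> 'a \<Rightarrow> bool" where
  "global_minimizer_in f C x \<longleftrightarrow> x \<in> C \<and> ereal (f x) = (INF y\<in>C. ereal (f y))"

definition has_continuum_of_global_minimizers ::
    "('a::topological_space \<Rightarrow> real) \<Rightarrow> 'a set \<Rightarrow> bool" where
  "has_continuum_of_global_minimizers f C \<longleftrightarrow>
     (\<exists>K\<subseteq>C. compact K \<and> connected K \<and> (\<exists>x\<in>K. \<exists>y\<in>K. x \<noteq> y) \<and>
        (\<forall>x\<in>K. global_minimizer_in f C x))"

end

theory Submission
  imports Defs
begin

text \<open>
  Minimise the maximum of \<open>f\<close> over the free homotopy class in \<open>C\<close> of a noncontractible loop; let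
  \<open>d < c\<close> be the infimum. Ekeland's principle on the space of loops replaces the gradient flow: it
  gives loops \<open>y\<close> with maximum close to \<open>d\<close> that no small perturbation improves at more than a
  prescribed rate, and pushing such a loop along the normalised negative gradient shows that the
  gradient is small at some point where \<open>f\<close> attains its maximum on the loop. The Palais-Smale
  condition yields a critical point \<open>x \<in> C\<close> at level \<open>d\<close> as a limit of such points. If \<open>x\<close> were a
  strict local minimizer, \<open>f\<close> would exceed \<open>d\<close> by a fixed amount on a small sphere around \<open>x\<close>, so
  some loop of the class would be trapped inside that ball, and hence contractible. Thus the
  second alternative always holds.
\<close>

section \<open>Riesz representation and the gradient of a \<open>C2\<close> function\<close>

text \<open>The representing vector is the minimiser of \<open>J\<close>. It exists because the
  near-minimisers form nested closed sets \<open>A n\<close> whose diameters shrink to zero in a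
  complete space; stationarity of \<open>J\<close> at it, in every direction \<open>h\<close>, is
  the desired formula.\<close>

lemma riesz_representation:
  fixes \<phi> :: "'a::{real_inner, complete_space} \<Rightarrow> real"
  assumes "bounded_linear \<phi>"
  obtains D where "\<And>h. \<phi> h = inner h D"
proof -
  interpret bounded_linear \<phi> by fact
  define J where "J x = inner x x - 2 * \<phi> x" for x
  define m where "m = Inf (range J)"
  obtain K where K: "\<And>x. \<bar>\<phi> x\<bar> \<le> norm x * K"
    using bounded by auto
  have "- K\<^sup>2 \<le> J x" for x
  proof -
    have "0 \<le> (norm x - K)\<^sup>2" by simp
    then show ?thesis
      using K[of x] unfolding J_def dot_square_norm power2_diff by (simp add: algebra_simps abs_le_iff)
  qed
  then have bdd: "bdd_below (range J)" by (rule bdd_belowI2)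
  then have m: "m \<le> J x" for x unfolding m_def by (simp add: cINF_lower)
  define A where "A n = {x. J x \<le> m + inverse (real (Suc n))}" for n
  obtain a where "\<And>n. a \<in> A n"
  proof (rule decreasing_closed_nest[of A])
    show "closed (A n)" for n
      unfolding A_def J_def by (intro closed_Collect_le continuous_intros continuous_on)
    show "A n \<noteq> {}" for n
      using cINF_less_iff[OF _ bdd, of "m + inverse (real (Suc n))"]
      by (auto simp: A_def m_def intro: less_imp_le)
    show "A n \<subseteq> A i" if "i \<le> n" for i n
    proof -
      have "inverse (real (Suc n)) \<le> inverse (real (Suc i))"
        using that by (intro le_imp_inverse_le) auto
      then show ?thesis unfolding A_def by (intro Collect_mono impI) linarith
    qed
    show "\<exists>n. \<forall>x\<in>A n. \<forall>y\<in>A n. dist x y < e" if "0 < e" for e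
    proof -
      have "0 < e\<^sup>2 / 4" using that by simp
      from reals_Archimedean[OF this]
      obtain n where n: "inverse (real (Suc n)) < e\<^sup>2 / 4" by blast
      have "dist x y < e" if "x \<in> A n" "y \<in> A n" for x y
      proof -
        \<comment> \<open>Parallelogram identity: the linear term cancels. As the midpoint has value
          at least \<open>m\<close>, two near-minimisers must lie close together.\<close>
        have "J ((1/2) *\<^sub>R (x + y)) = (J x + J y) / 2 - (norm (x - y))\<^sup>2 / 4"
          unfolding J_def scaleR add power2_norm_eq_inner
          by (simp add: inner_simps inner_commute field_simps)
        then have "m \<le> (J x + J y) / 2 - (norm (x - y))\<^sup>2 / 4"
          using m by metis
        moreover have "J x \<le> m + inverse (real (Suc n))" "J y \<le> m + inverse (real (Suc n))"
          using that unfolding A_def by blast+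
        ultimately have "(norm (x - y))\<^sup>2 < e\<^sup>2"
          using n by argo
        then show ?thesis
          using \<open>0 < e\<close> by (simp add: dist_norm power_less_imp_less_base)
      qed
      then show ?thesis by blast
    qed
  qed blast
  then have a: "J a \<le> m + inverse (real (Suc n))" for n by (auto simp: A_def)
  have "J a \<le> m"
  proof (rule field_le_epsilon)
    show "J a \<le> m + e" if "0 < e" for e
      using reals_Archimedean[OF that] a by (meson add_le_cancel_left less_imp_le order_trans)
  qed
  have "\<phi> h = inner h a" for h
  proof (cases "h = 0")
    case False
    define b where "b = \<phi> h - inner h a"
    \<comment> \<open>This \<open>t\<close> minimises the quadratic that \<open>J\<close> becomes on
      the line through \<open>a\<close> in direction \<open>h\<close>; it would lower
      \<open>J\<close> below \<open>m\<close> unless \<open>b = 0\<close>.\<close>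
    define t where "t = b / inner h h"
    have "J (a + t *\<^sub>R h) = J a + t\<^sup>2 * inner h h - 2 * t * b"
      unfolding J_def b_def add scaleR
      by (simp add: algebra_simps inner_commute power2_eq_square)
    also have "\<dots> = J a - b\<^sup>2 / inner h h"
      using False by (simp add: t_def power2_eq_square field_simps)
    finally have "b\<^sup>2 / inner h h \<le> 0"
      using \<open>J a \<le> m\<close> m[of "a + t *\<^sub>R h"] by simp
    then have "b = 0"
      using False by (simp add: divide_le_0_iff inner_gt_zero_iff[symmetric] del: inner_gt_zero_iff)
    then show ?thesis by (simp add: b_def)
  qed (simp add: zero)
  then show thesis using that by blast
qed

text \<open>\<open>grad\<close> is a definite description, so it is meaningful only once Riesz gives
  existence and uniqueness of derivatives gives uniqueness. Continuity is inherited from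
  \<open>f'\<close>, because passing to the representing vector does not increase distances.\<close>

lemma C2_imp_gderiv_continuous:
  fixes f :: "'a::{real_inner, complete_space} \<Rightarrow> real"
  assumes "C2 f"
  shows C2_GDERIV_grad: "GDERIV f x :> grad f x"
    and C2_continuous_grad: "continuous_on UNIV (grad f)"
proof -
  obtain f' :: "'a \<Rightarrow> 'a \<Rightarrow>\<^sub>L real" and f''
    where f': "\<And>x. (f has_derivative blinfun_apply (f' x)) (at x)"
      and f'': "\<And>x. (f' has_derivative blinfun_apply (f'' x)) (at x)"
    using assms unfolding C2_def by blast
  have gd: "GDERIV f x :> grad f x" for x
  proof -
    obtain D where D: "\<And>h. blinfun_apply (f' x) h = inner h D"
      using riesz_representation[OF blinfun.bounded_linear_right[of "f' x"]] by blast
    then have "blinfun_apply (f' x) = (\<lambda>h. inner h D)" by auto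
    then have D': "GDERIV f x :> D" using f'[of x] by (simp add: gderiv_def)
    moreover have "D' = D" if "GDERIV f x :> D'" for D'
    proof -
      have "(\<lambda>h. inner h D') = (\<lambda>h. inner h D)"
        using has_derivative_unique that D' unfolding gderiv_def by blast
      then have "inner (D' - D) D' = inner (D' - D) D" by meson
      then show ?thesis by (metis inner_eq_zero_iff inner_diff_right right_minus_eq)
    qed
    ultimately show ?thesis unfolding grad_def by (rule theI)
  qed
  then show "GDERIV f x :> grad f x" .
  have f'_eq: "blinfun_apply (f' x) h = inner h (grad f x)" for x h
    using has_derivative_unique[OF f' gd[of x, unfolded gderiv_def]] by metis
  \<comment> \<open>The functional \<open>f' x - f' y\<close>, tested on its own representing vector
    \<open>?D\<close>, gives the square of the norm of \<open>?D\<close>; one factor then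
    cancels.\<close>
  have lip: "dist (grad f x) (grad f y) \<le> dist (f' x) (f' y)" for x y
  proof -
    let ?D = "grad f x - grad f y"
    have "norm ?D * norm ?D = inner ?D ?D" by (simp add: dot_square_norm power2_eq_square)
    also have "\<dots> = blinfun_apply (f' x - f' y) ?D"
      by (simp add: blinfun.diff_left f'_eq inner_diff_right)
    also have "\<dots> \<le> norm (f' x - f' y) * norm ?D"
      using norm_blinfun[of "f' x - f' y" ?D] by simp
    finally show ?thesis
      by (cases "norm ?D = 0") (auto simp: dist_norm)
  qed
  have "continuous_on UNIV f'"
    by (rule has_derivative_continuous_on) (rule has_derivative_at_withinI[OF f''])
  then show "continuous_on UNIV (grad f)"
    unfolding continuous_on_iff using le_less_trans[OF lip] by blast
qed

section \<open>Ekeland's variational principle\<close>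

text \<open>Closedness is asked only of sublevels up to \<open>\<Phi> x0\<close>, which fits a class
  of loops that need not be closed as a whole. Choosing almost minimal points successively in the
  sets \<open>T (X n)\<close> makes these shrink to one point \<open>y\<close>, and a violator
  \<open>z\<close> of the conclusion would lie in all of them too.\<close>

lemma ekeland_variational_principle:
  fixes \<Phi> :: "'m::complete_space \<Rightarrow> real"
  assumes x0: "x0 \<in> S"
    and below: "\<And>x. x \<in> S \<Longrightarrow> m \<le> \<Phi> x"
    and closed: "\<And>b. b \<le> \<Phi> x0 \<Longrightarrow> closed {x \<in> S. \<Phi> x \<le> b}"
    and k: "0 < k"
  obtains y where "y \<in> S" "\<Phi> y \<le> \<Phi> x0"
    "\<And>z. z \<in> S \<Longrightarrow> z \<noteq> y \<Longrightarrow> \<Phi> y < \<Phi> z + k * dist y z"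
proof -
  \<comment> \<open>The points below \<open>x\<close> in Ekeland's order; \<open>Tself\<close> and
    \<open>Tmono\<close> are its reflexivity and transitivity.\<close>
  define T where "T x = {z \<in> S. \<Phi> z + k * dist x z \<le> \<Phi> x}" for x
  have Tself: "x \<in> T x" if "x \<in> S" for x using that by (simp add: T_def)
  have Tmono: "T y \<subseteq> T x" if "y \<in> T x" for x y
  proof
    fix z assume "z \<in> T y"
    moreover have "k * dist x z \<le> k * (dist x y + dist y z)"
      using k dist_triangle by simp
    ultimately show "z \<in> T x" using that by (simp add: T_def algebra_simps)
  qed
  have Tle: "\<Phi> z \<le> \<Phi> x" if "z \<in> T x" for x z
    using that k zero_le_dist[of x z] unfolding T_def
    by (smt (verit) mem_Collect_eq mult_nonneg_nonneg)
  have Tclosed: "closed (T x)" if "\<Phi> x \<le> \<Phi> x0" for x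
    unfolding closed_sequential_limits
  proof (intro allI impI, elim conjE)
    fix z l assume z: "\<forall>n. z n \<in> T x" and l: "z \<longlonglongrightarrow> l"
    have "l \<in> S \<and> \<Phi> l \<le> \<Phi> x - k * dist x l + \<eta>" if "0 < \<eta>" for \<eta>
    proof -
      \<comment> \<open>The bound on \<open>\<Phi> (z n)\<close> varies with \<open>n\<close>; the
        slack \<open>\<eta>\<close> puts the tail of the sequence into one fixed sublevel, and the
        cap \<open>\<Phi> x0\<close> makes that sublevel closed by assumption.\<close>
      define b where "b = min (\<Phi> x0) (\<Phi> x - k * dist x l + \<eta>)"
      have "(\<lambda>n. \<Phi> x - k * dist x (z n)) \<longlonglongrightarrow> \<Phi> x - k * dist x l"
        by (intro tendsto_intros l)
      then have "\<forall>\<^sub>F n in sequentially. \<Phi> x - k * dist x (z n) < \<Phi> x - k * dist x l + \<eta>"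
        using that by (intro order_tendstoD) auto
      then have "\<forall>\<^sub>F n in sequentially. z n \<in> {x \<in> S. \<Phi> x \<le> b}"
      proof (rule eventually_mono)
        fix n assume "\<Phi> x - k * dist x (z n) < \<Phi> x - k * dist x l + \<eta>"
        moreover have "z n \<in> S" "\<Phi> (z n) + k * dist x (z n) \<le> \<Phi> x" "\<Phi> (z n) \<le> \<Phi> x0"
          using z Tle[of "z n" x] \<open>\<Phi> x \<le> \<Phi> x0\<close> by (auto simp: T_def)
        ultimately show "z n \<in> {x \<in> S. \<Phi> x \<le> b}" by (simp add: b_def)
      qed
      moreover have "closed {x \<in> S. \<Phi> x \<le> b}" by (rule closed) (simp add: b_def)
      ultimately have "l \<in> {x \<in> S. \<Phi> x \<le> b}"
        by (intro Lim_in_closed_set[OF _ _ trivial_limit_sequentially l])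
      then show ?thesis by (simp add: b_def)
    qed
    note bound = this
    have "\<Phi> l \<le> \<Phi> x - k * dist x l"
      by (rule field_le_epsilon) (use bound in blast)
    with bound[OF zero_less_one] show "l \<in> T x" by (simp add: T_def)
  qed
  have "\<exists>z\<in>T x. \<forall>w\<in>T x. \<Phi> z \<le> \<Phi> w + (1/2)^n" if "x \<in> S" for x and n :: nat
  proof -
    have ne: "T x \<noteq> {}" using Tself that by blast
    have bdd: "bdd_below (\<Phi> ` T x)" using below by (auto intro!: bdd_belowI[of _ m] simp: T_def)
    have "Inf (\<Phi> ` T x) < Inf (\<Phi> ` T x) + (1/2)^n" by simp
    then obtain z where "z \<in> T x" "\<Phi> z < Inf (\<Phi> ` T x) + (1/2)^n"
      using cINF_less_iff[OF ne bdd] by blast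
    moreover have "Inf (\<Phi> ` T x) \<le> \<Phi> w" if "w \<in> T x" for w
      using bdd that by (simp add: cINF_lower)
    ultimately show ?thesis by force
  qed
  then obtain nxt where nxt: "\<And>x n. x \<in> S \<Longrightarrow> nxt x n \<in> T x"
      "\<And>x n w. x \<in> S \<Longrightarrow> w \<in> T x \<Longrightarrow> \<Phi> (nxt x n) \<le> \<Phi> w + (1/2)^n"
    by metis
  define X where "X = rec_nat x0 (\<lambda>n x. nxt x n)"
  have X0: "X 0 = x0" and XS: "X (Suc n) = nxt (X n) n" for n by (simp_all add: X_def)
  have XinS: "X n \<in> S" for n
    by (induction n) (use x0 nxt(1) in \<open>auto simp: X0 XS T_def\<close>)
  have step: "T (X (Suc n)) \<subseteq> T (X n)" for n
    using Tmono nxt(1) XinS by (simp add: XS)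
  have anti: "T (X n) \<subseteq> T (X i)" if "i \<le> n" for i n
    using that by (rule lift_Suc_antimono_le[of "\<lambda>n. T (X n)", OF step])
  have X_le: "\<Phi> (X n) \<le> \<Phi> x0" for n
    using anti[of 0 n] Tself[OF XinS] Tle by (auto simp: X0)
  \<comment> \<open>Near-minimality of \<open>X (Suc n)\<close> on \<open>T (X n)\<close> limits any
    further decrease of \<open>\<Phi>\<close>, and membership in \<open>T\<close> makes that
    decrease at least \<open>k\<close> times the distance.\<close>
  have close: "k * dist (X (Suc n)) z \<le> (1/2)^n" if "z \<in> T (X (Suc n))" for n z
  proof -
    have "\<Phi> (X (Suc n)) \<le> \<Phi> z + (1/2)^n"
      using nxt(2)[OF XinS, of z n n] that step by (auto simp: XS)
    then show ?thesis using that by (simp add: T_def)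
  qed
  have small: "\<exists>n. \<forall>x\<in>T (X n). \<forall>y\<in>T (X n). dist x y < e" if "0 < e" for e
  proof -
    have "0 < k * e / 2" using that k by simp
    from real_arch_pow_inv[OF this, of "1/2"]
    obtain n where n: "(1/2::real)^n < k * e / 2" by auto
    have "dist x y < e" if "x \<in> T (X (Suc n))" "y \<in> T (X (Suc n))" for x y
    proof -
      have "k * dist x y \<le> k * dist (X (Suc n)) x + k * dist (X (Suc n)) y"
        using k dist_triangle3[of x y "X (Suc n)"] by (simp flip: distrib_left)
      also have "\<dots> < k * e" using close[OF that(1)] close[OF that(2)] n by linarith
      finally show ?thesis using k by simp
    qed
    then show ?thesis by blast
  qed
  obtain y where y: "\<And>n. y \<in> T (X n)"
  proof (rule decreasing_closed_nest[of "\<lambda>n. T (X n)"])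
    show "closed (T (X n))" for n by (rule Tclosed[OF X_le])
    show "T (X n) \<noteq> {}" for n using Tself[OF XinS] by blast
    show "T (X n) \<subseteq> T (X i)" if "i \<le> n" for i n by (rule anti[OF that])
    show "\<exists>n. \<forall>x\<in>T (X n). \<forall>y\<in>T (X n). dist x y < e" if "0 < e" for e
      by (rule small[OF that])
  qed blast
  show thesis
  proof
    show "y \<in> S" using y[of 0] by (simp add: T_def)
    show "\<Phi> y \<le> \<Phi> x0" using Tle[OF y[of 0]] by (simp add: X0)
    show "\<Phi> y < \<Phi> z + k * dist y z" if "z \<in> S" "z \<noteq> y" for z
    proof (rule ccontr)
      assume "\<not> ?thesis"
      then have "z \<in> T (X n)" for n using that Tmono[OF y[of n]] by (auto simp: T_def)
      then show False
        using small[of "dist y z"] y that by fastforce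
    qed
  qed
qed

section \<open>Perturbing loops and their maximum\<close>

text \<open>By compactness one radius \<open>e\<close> keeps all balls around points of the loop
  inside \<open>S\<close>, so nearby loops can be joined to it linearly. Hence free homotopy classes
  are stable under uniformly small perturbations.\<close>

lemma homotopic_loops_close:
  fixes g :: "real \<Rightarrow> 'a::real_normed_vector"
  assumes "path g" "pathfinish g = pathstart g" "path_image g \<subseteq> S" "open S"
  obtains e where "0 < e"
    "\<And>h :: real \<Rightarrow> 'a. path h \<Longrightarrow> pathfinish h = pathstart h \<Longrightarrow>
      (\<And>t::real. t \<in> {0..1} \<Longrightarrow> dist (g t) (h t) < e) \<Longrightarrow> homotopic_loops S g h"
proof -
  obtain e where e: "0 < e" "\<And>x. x \<in> path_image g \<Longrightarrow> ball x e \<subseteq> S"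
    using Heine_Borel_lemma[OF compact_path_image[OF assms(1)], of "{S}"] assms(3,4) by auto
  show thesis
  proof
    fix h :: "real \<Rightarrow> 'a"
    assume h: "path h" "pathfinish h = pathstart h" "\<And>t::real. t \<in> {0..1} \<Longrightarrow> dist (g t) (h t) < e"
    show "homotopic_loops S g h"
    proof (rule homotopic_loops_nearby_explicit)
      fix t :: real and x assume t: "t \<in> {0..1}" and x: "x \<notin> S"
      have "\<not> dist (g t) x < e" using e(2)[of "g t"] t x by (auto simp: path_image_def)
      then show "norm (h t - g t) < norm (g t - x)"
        using h(3)[OF t] by (simp add: dist_norm norm_minus_commute)
    qed (use assms h in auto)
  qed (rule e(1))
qed

definition loop_max :: "('a \<Rightarrow> real) \<Rightarrow> (real \<Rightarrow> 'a) \<Rightarrow> real" where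
  "loop_max f g = (SUP s\<in>{0..1}. f (g s))"

lemma loop_max:
  fixes f :: "'a::topological_space \<Rightarrow> real"
  assumes "continuous_on UNIV f" "continuous_on {0..1} g"
  shows loop_max_attained: "\<exists>s\<in>{0..1}. f (g s) = loop_max f g"
    and loop_max_upper: "s \<in> {0..1} \<Longrightarrow> f (g s) \<le> loop_max f g"
    and loop_max_le_iff: "loop_max f g \<le> b \<longleftrightarrow> (\<forall>s\<in>{0..1}. f (g s) \<le> b)"
proof -
  have "continuous_on {0..1} (\<lambda>s. f (g s))"
    using assms continuous_on_compose2 by blast
  then obtain s where s: "s \<in> {0..1}" "\<And>t. t \<in> {0..1} \<Longrightarrow> f (g t) \<le> f (g s)"
    using continuous_attains_sup[of "{0..1::real}" "\<lambda>s. f (g s)"] by auto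
  then have eq: "loop_max f g = f (g s)"
    unfolding loop_max_def by (intro cSup_eq_maximum) auto
  show "\<exists>s\<in>{0..1}. f (g s) = loop_max f g" "s \<in> {0..1} \<Longrightarrow> f (g s) \<le> loop_max f g" for s
    using s eq by auto
  show "loop_max f g \<le> b \<longleftrightarrow> (\<forall>s\<in>{0..1}. f (g s) \<le> b)"
    unfolding eq using s by (meson order_trans)
qed

text \<open>Pushing the loop by \<open>t\<close> along a descent field \<open>v\<close> moves it by
  at most \<open>t\<close>, so by \<open>min\<close> its maximum drops by at most
  \<open>k * t\<close>. At a maximum point of the pushed loop the mean value theorem finds a slope
  of at least \<open>- k\<close>; as \<open>t\<close> tends to 0 such points accumulate at a maximum
  point of \<open>y\<close> with the same slope bound.\<close>

lemma almost_critical_point_on_loop: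
  fixes f :: "'a::real_inner \<Rightarrow> real" and y :: "real \<Rightarrow>\<^sub>C 'a"
  assumes G: "\<And>x. GDERIV f x :> G x" and contG: "continuous_on UNIV G"
    and loop: "y 0 = y 1" and k: "0 < k" and e: "0 < e"
    and min: "\<And>z :: real \<Rightarrow>\<^sub>C 'a. apply_bcontfun z 0 = apply_bcontfun z 1 \<Longrightarrow> dist y z < e \<Longrightarrow>
      loop_max f y \<le> loop_max f (apply_bcontfun z) + k * dist y z"
  obtains s where "s \<in> {0..1}" "f (y s) = loop_max f y" "norm (G (y s)) \<le> k"
proof -
  have contf: "continuous_on UNIV f"
    using G unfolding gderiv_def by (meson has_derivative_at_withinI has_derivative_continuous_on)
  have conty: "continuous_on T y" for T by simp
  \<comment> \<open>The unit negative gradient where the gradient has norm at least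
    \<open>k\<close>; the cutoff \<open>k\<close> keeps the field continuous where the gradient
    vanishes.\<close>
  define v where "v s = - (1 / max (norm (G (y s))) k) *\<^sub>R G (y s)" for s
  have contGy: "continuous_on UNIV (\<lambda>s. G (y s))"
    using contG conty continuous_on_compose2 by blast
  have contv: "continuous_on UNIV v"
    unfolding v_def using k by (intro continuous_intros contGy) (auto simp: max_def)
  have v_le: "norm (v s) \<le> 1" for s
    using k by (simp add: v_def)
  have step: "\<exists>s\<in>{0..1}. \<exists>u\<in>{0..t}. - k \<le> inner (v s) (G (y s + u *\<^sub>R v s)) \<and>
      loop_max f y - k * t \<le> f (y s + t *\<^sub>R v s)" if t: "0 < t" "t < e" for t
  proof -
    have "(\<lambda>s. y s + t *\<^sub>R v s) \<in> bcontfun"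
    proof (rule plus_cont)
      show "(\<lambda>s. t *\<^sub>R v s) \<in> bcontfun"
        by (rule scaleR_cont, rule bcontfun_normI[OF contv v_le])
    qed (rule apply_bcontfun)
    then obtain z :: "real \<Rightarrow>\<^sub>C 'a" where z: "\<And>s. z s = y s + t *\<^sub>R v s"
      by (metis bcontfunE)
    have dist_le: "dist y z \<le> t"
    proof (rule dist_bound)
      fix s show "dist (y s) (z s) \<le> t"
        using mult_left_mono[OF v_le[of s], of t] t by (simp add: z dist_norm)
    qed
    moreover have "z 0 = z 1" using loop by (simp add: z v_def)
    ultimately have "loop_max f y \<le> loop_max f z + k * dist y z"
      using t by (intro min) auto
    also have "\<dots> \<le> loop_max f z + k * t" using dist_le k by simp
    finally have le: "loop_max f y - k * t \<le> loop_max f z" by simp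
    \<comment> \<open>A maximum point of the pushed loop \<open>z\<close>, not of \<open>y\<close>:
      on \<open>y\<close> its value is at most the maximum, which bounds the average slope from
      below.\<close>
    obtain s where s: "s \<in> {0..1}" "f (z s) = loop_max f z"
      using loop_max_attained[OF contf, of z] by auto
    have "\<exists>u>0. u < t \<and> f (y s + t *\<^sub>R v s) - f (y s + 0 *\<^sub>R v s)
        = (t - 0) * inner (v s) (G (y s + u *\<^sub>R v s))"
    proof (rule MVT2[OF t(1)])
      fix u
      have "((\<lambda>u. y s + u *\<^sub>R v s) has_derivative (\<lambda>h. h *\<^sub>R v s)) (at u)"
        by (auto intro!: derivative_eq_intros)
      from has_derivative_compose[OF this G[unfolded gderiv_def]]
      show "((\<lambda>u. f (y s + u *\<^sub>R v s)) has_real_derivative inner (v s) (G (y s + u *\<^sub>R v s))) (at u)"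
        by (simp add: has_field_derivative_def mult_commute_abs)
    qed
    then obtain u where u: "0 < u" "u < t"
        "f (z s) - f (y s) = t * inner (v s) (G (y s + u *\<^sub>R v s))"
      by (auto simp: z)
    have "f (y s) \<le> loop_max f y" using loop_max_upper[OF contf conty s(1)] .
    then have "t * (- k) \<le> t * inner (v s) (G (y s + u *\<^sub>R v s))"
      using u(3) s(2) le by (simp add: algebra_simps)
    then have "- k \<le> inner (v s) (G (y s + u *\<^sub>R v s))"
      using t(1) by (metis mult_le_cancel_left_pos)
    moreover have "loop_max f y - k * t \<le> f (y s + t *\<^sub>R v s)"
      using le s(2) by (simp add: z)
    ultimately show ?thesis using s(1) u(1,2) by (meson atLeastAtMost_iff less_imp_le)
  qed
  \<comment> \<open>Any null sequence strictly between 0 and \<open>e\<close> would do; the shift by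
    2 makes already the first term smaller than \<open>e\<close>.\<close>
  define t where "t n = e * inverse (real (n + 2))" for n
  have t: "0 < t n" "t n < e" for n
    using e mult_strict_left_mono[of "inverse (real (n + 2))" 1 e]
    by (auto simp: t_def inverse_less_1_iff)
  have t0: "t \<longlonglongrightarrow> 0"
    using tendsto_mult_right_zero[OF LIMSEQ_ignore_initial_segment[OF lim_inverse_n, of 2], of e]
    by (simp add: t_def[abs_def])
  have "\<forall>n. \<exists>s u. s \<in> {0..1} \<and> u \<in> {0..t n} \<and> - k \<le> inner (v s) (G (y s + u *\<^sub>R v s)) \<and>
      loop_max f y - k * t n \<le> f (y s + t n *\<^sub>R v s)"
    using step[OF t] by blast
  then obtain s u where su: "\<And>n. s n \<in> {0..1}" "\<And>n. u n \<in> {0..t n}"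
      "\<And>n. - k \<le> inner (v (s n)) (G (y (s n) + u n *\<^sub>R v (s n)))"
      "\<And>n. loop_max f y - k * t n \<le> f (y (s n) + t n *\<^sub>R v (s n))"
    by metis
  obtain l r where l: "l \<in> {0..1}" and r: "strict_mono r" and lim: "(s \<circ> r) \<longlonglongrightarrow> l"
    using compact_Icc[of 0 "1::real"] su(1) unfolding compact_def by metis
  have tr: "(\<lambda>n. t (r n)) \<longlonglongrightarrow> 0"
    using LIMSEQ_subseq_LIMSEQ[OF t0 r] by (simp add: o_def)
  have ur: "(\<lambda>n. u (r n)) \<longlonglongrightarrow> 0"
    using su(2) by (intro tendsto_sandwich[OF _ _ tendsto_const tr]) (auto intro!: always_eventually)
  have at_l: "(\<lambda>n. h (s (r n))) \<longlonglongrightarrow> h l" if "continuous_on UNIV h" for h :: "real \<Rightarrow> 'a"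
    using continuous_on_tendsto_compose[OF that lim] by (simp add: o_def)
  have pt: "(\<lambda>n. y (s (r n)) + w n *\<^sub>R v (s (r n))) \<longlonglongrightarrow> y l" if "w \<longlonglongrightarrow> 0" for w :: "nat \<Rightarrow> real"
    using tendsto_add[OF at_l[OF conty] tendsto_scaleR[OF that at_l[OF contv]]] by simp
  have "loop_max f y - k * 0 \<le> f (y l)"
  proof (rule LIMSEQ_le)
    show "(\<lambda>n. f (y (s (r n)) + t (r n) *\<^sub>R v (s (r n)))) \<longlonglongrightarrow> f (y l)"
      by (rule continuous_on_tendsto_compose[OF contf pt[OF tr]]) auto
    show "(\<lambda>n. loop_max f y - k * t (r n)) \<longlonglongrightarrow> loop_max f y - k * 0"
      by (intro tendsto_intros tr)
  qed (use su(4) in auto)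
  with loop_max_upper[OF contf conty l] have "f (y l) = loop_max f y" by simp
  moreover have "- k \<le> inner (v l) (G (y l))"
  proof (rule LIMSEQ_le_const)
    show "(\<lambda>n. inner (v (s (r n))) (G (y (s (r n)) + u (r n) *\<^sub>R v (s (r n))))) \<longlonglongrightarrow> inner (v l) (G (y l))"
      by (intro tendsto_inner at_l[OF contv] continuous_on_tendsto_compose[OF contG pt[OF ur]]) auto
  qed (use su(3) in auto)
  \<comment> \<open>If the norm exceeded \<open>k\<close>, the field at \<open>l\<close> would be
    the unit negative gradient, with slope minus that norm, below \<open>- k\<close>.\<close>
  moreover have "norm (G (y l)) \<le> k" if "- k \<le> inner (v l) (G (y l))"
  proof (rule ccontr)
    assume "\<not> norm (G (y l)) \<le> k"
    then have "inner (v l) (G (y l)) = - norm (G (y l))"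
      using k by (simp add: v_def max_def dot_square_norm power2_eq_square)
    then show False using that \<open>\<not> norm (G (y l)) \<le> k\<close> by simp
  qed
  ultimately show thesis using l that by blast
qed

text \<open>Loops are modelled by bounded continuous functions on the whole line, whose type is a
  complete metric space; only their values on the unit interval enter \<open>loop_max\<close> and
  the homotopy class.\<close>

lemma bcontfun_extends_path:
  fixes g :: "real \<Rightarrow> 'a::real_normed_vector"
  assumes "path g"
  obtains h :: "real \<Rightarrow>\<^sub>C 'a" where "\<And>s. s \<in> {0..1} \<Longrightarrow> h s = g s"
proof -
  have "continuous_on (cbox 0 1) g" using assms by (simp add: path_def)
  then obtain h :: "real \<Rightarrow>\<^sub>C 'a" where "\<And>s. s \<in> cbox 0 1 \<Longrightarrow> h s = g s"
    using continuous_on_cbox_bcontfunE by metis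
  then show thesis using that[of h] by simp
qed

section \<open>Loops trapped near a strict local minimizer\<close>

text \<open>The image is connected and meets the ball, but its values are too low for it to meet the
  sphere, so it stays inside; a ball is convex, so the loop contracts linearly to the
  centre.\<close>

lemma loop_in_ball_contractible:
  fixes f :: "'a::real_normed_vector \<Rightarrow> real"
  assumes "path g" "pathfinish g = pathstart g" "ball x r \<subseteq> C"
    and "s \<in> {0..1}" "g s \<in> ball x r"
    and "\<And>t. t \<in> {0..1} \<Longrightarrow> f (g t) < b" "\<And>z. z \<in> frontier (ball x r) \<Longrightarrow> b \<le> f z"
  shows "homotopic_loops C g (linepath x x)"
proof -
  have sub: "path_image g \<subseteq> ball x r"
  proof (rule ccontr)
    assume "\<not> ?thesis"
    moreover have "g s \<in> path_image g \<inter> ball x r"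
      using assms(4,5) by (auto simp: path_image_def)
    ultimately have "path_image g \<inter> frontier (ball x r) \<noteq> {}"
      by (intro connected_Int_frontier connected_path_image[OF assms(1)]) blast+
    then show False using assms(6,7) by (force simp: path_image_def)
  qed
  have "0 < r" using assms(5) by (metis ball_eq_empty empty_iff not_le)
  have seg: "closed_segment (g t) (linepath x x t) \<subseteq> ball x r" if "t \<in> {0..1}" for t
  proof (rule closed_segment_subset)
    show "g t \<in> ball x r" using sub that by (auto simp: path_image_def simp del: mem_ball)
    show "linepath x x t \<in> ball x r"
      using \<open>0 < r\<close> by (simp add: linepath_def flip: scaleR_left.add)
  qed simp
  have "homotopic_loops (ball x r) g (linepath x x)"
    by (rule homotopic_loops_linear) (use assms(1,2) seg in auto)
  then show ?thesis using assms(3) homotopic_loops_subset by blast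
qed

lemma strict_local_minimizer_barrier:
  assumes "strict_local_minimizer f x" "open C" "x \<in> C"
  obtains r b where "0 < r" "ball x r \<subseteq> C" "f x < b" "\<And>z. z \<in> frontier (ball x r) \<Longrightarrow> b \<le> f z"
proof -
  obtain r0 where r0: "0 < r0"
      "\<And>r. 0 < r \<Longrightarrow> r < r0 \<Longrightarrow> ereal (f x) < (INF z\<in>frontier (ball x r). ereal (f z))"
    using assms(1) unfolding strict_local_minimizer_def by blast
  obtain r1 where r1: "0 < r1" "ball x r1 \<subseteq> C"
    using assms(2,3) open_contains_ball by blast
  define r where "r = min r0 r1 / 2"
  have r: "0 < r" "r < r0" "r < r1" using r0 r1 by (auto simp: r_def)
  \<comment> \<open>The infimum is an extended real, infinite if the frontier is empty; density
    yields a real level in either case.\<close>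
  obtain b where b: "ereal (f x) < ereal b" "ereal b < (INF z\<in>frontier (ball x r). ereal (f z))"
    using ereal_dense2[OF r0(2)[OF r(1,2)]] by blast
  show thesis
  proof
    show "ball x r \<subseteq> C" using r1(2) r(3) by (meson less_imp_le order_trans subset_ball)
    show "b \<le> f z" if "z \<in> frontier (ball x r)" for z
      using order_less_le_trans[OF b(2) INF_lower[OF that]] by simp
  qed (use r b in auto)
qed

section \<open>Minimax over a free homotopy class\<close>

theorem theorem1p14:
  fixes f :: "'a::{real_inner, complete_space} \<Rightarrow> real" and c :: real and C :: "'a set"
  assumes "C2 f"
    and "\<forall>x. 0 \<le> f x"
    and "{x. f x < c} \<noteq> {}"
    and "\<not> loops_contractible {x. f x < c}"
    and "\<forall>c0. 0 \<le> c0 \<and> c0 < c \<longrightarrow> PS_condition f c0"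
    and "C \<in> components {x. f x < c}"
    and "\<not> loops_contractible C"
  shows "has_continuum_of_global_minimizers f C \<or>
    (\<exists>x\<in>C. critical_point f x \<and> \<not> strict_local_minimizer f x)"
proof -
  note gd = C2_GDERIV_grad[OF assms(1)] and contG = C2_continuous_grad[OF assms(1)]
  have contf: "continuous_on UNIV f"
    using gd unfolding gderiv_def by (meson has_derivative_at_withinI has_derivative_continuous_on)
  have openU: "open {x. f x < c}"
    by (intro open_Collect_less contf continuous_intros)
  have openC: "open C" using open_components[OF openU] assms(6) by blast
  have C_sub: "C \<subseteq> {x. f x < c}" using assms(6) in_components_subset by blast
  \<comment> \<open>A component is closed relative to the sublevel set, so limits can leave
    \<open>C\<close> only by reaching the level \<open>c\<close>.\<close>
  have limit_in_C: "x \<in> C" if "x \<in> closure C" "f x < c" for x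
    using closedin_component[OF assms(6)] that unfolding closedin_closed_eq
    by (metis (no_types, lifting) Int_iff closedin_closed closure_minimal inf_le2 mem_Collect_eq subsetD)

  obtain \<gamma> where loop: "loop_in C \<gamma>" and not_contractible: "\<not> contractible_loop C \<gamma>"
    using assms(7) unfolding loops_contractible_def by blast
  define S where "S = {g :: real \<Rightarrow>\<^sub>C 'a. homotopic_loops C \<gamma> (apply_bcontfun g)}"
  have S_path: "path (apply_bcontfun g)" and S_loop: "g 0 = g 1"
    and S_sub: "path_image (apply_bcontfun g) \<subseteq> C" if "g \<in> S" for g :: "real \<Rightarrow>\<^sub>C 'a"
  proof -
    have "homotopic_loops C \<gamma> g" using that by (simp add: S_def)
    from homotopic_loops_imp_path[OF this] homotopic_loops_imp_loop[OF this]
      homotopic_loops_imp_subset[OF this]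
    show "path (apply_bcontfun g)" "g 0 = g 1" "path_image (apply_bcontfun g) \<subseteq> C"
      by (simp_all add: pathstart_def pathfinish_def)
  qed
  \<comment> \<open>Stated for any loop in \<open>C\<close> rather than for members of
    \<open>S\<close>, since it is also applied to a limit loop before that is known to lie in
    \<open>S\<close>.\<close>
  have S_near: "\<exists>e>0. \<forall>h :: real \<Rightarrow>\<^sub>C 'a.
      apply_bcontfun h 0 = apply_bcontfun h 1 \<and> dist g h < e \<longrightarrow> homotopic_loops C g (apply_bcontfun h)"
    if "g 0 = g 1" "path_image (apply_bcontfun g) \<subseteq> C" for g :: "real \<Rightarrow>\<^sub>C 'a"
  proof -
    have "path (apply_bcontfun g)" "pathfinish g = pathstart g"
      using that by (simp_all add: path_def pathstart_def pathfinish_def)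
    from homotopic_loops_close[OF this that(2) openC] obtain e where "0 < e" and
      e: "\<And>h :: real \<Rightarrow> 'a. path h \<Longrightarrow> pathfinish h = pathstart h \<Longrightarrow>
        (\<And>t::real. t \<in> {0..1} \<Longrightarrow> dist (g t) (h t) < e) \<Longrightarrow> homotopic_loops C g h"
      by metis
    then show ?thesis
      by (intro exI[of _ e])
        (auto intro!: e dist_fun_lt_imp_dist_val_lt simp: path_def pathstart_def pathfinish_def)
  qed
  let ?\<Phi> = "\<lambda>g :: real \<Rightarrow>\<^sub>C 'a. loop_max f (apply_bcontfun g)"
  note max_upper = loop_max_upper[OF contf continuous_on_apply_bcontfun]
    and max_le_iff = loop_max_le_iff[OF contf continuous_on_apply_bcontfun]
    and max_attained = loop_max_attained[OF contf continuous_on_apply_bcontfun]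
  have \<Phi>_nonneg: "0 \<le> ?\<Phi> g" for g
    using max_upper[of 0 g] assms(2) by (meson atLeastAtMost_iff order_refl order_trans zero_le_one)
  have \<Phi>_less: "?\<Phi> g < c" if "g \<in> S" for g
    using max_attained[of g] S_sub[OF that] C_sub by (force simp: path_image_def)
  \<comment> \<open>A uniform limit of loops in \<open>S\<close> might touch level \<open>c\<close>;
    a bound \<open>b < c\<close> keeps it in \<open>C\<close>, where it is homotopic to nearby
    members of the sequence.\<close>
  have closed_sublevel: "closed {g \<in> S. ?\<Phi> g \<le> b}" if "b < c" for b
    unfolding closed_sequential_limits
  proof (intro allI impI, elim conjE)
    fix g l assume g: "\<forall>n. g n \<in> {g \<in> S. ?\<Phi> g \<le> b}" and l: "g \<longlonglongrightarrow> l"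
    have pt: "(\<lambda>n. g n s) \<longlonglongrightarrow> l s" for s
      using tendsto_uniform_limitI[OF tendsto_bcontfun_uniform_limit[OF l]] by simp
    have le: "f (l s) \<le> b" if "s \<in> {0..1}" for s
    proof (rule LIMSEQ_le_const2)
      show "(\<lambda>n. f (g n s)) \<longlonglongrightarrow> f (l s)"
        by (rule continuous_on_tendsto_compose[OF contf pt]) auto
    qed (use g max_le_iff that in auto)
    have "l s \<in> C" if "s \<in> {0..1}" for s
    proof (rule limit_in_C)
      have "g n s \<in> C" for n using g S_sub that by (fastforce simp: path_image_def)
      then show "l s \<in> closure C"
        unfolding closure_sequential using pt by (intro exI[of _ "\<lambda>n. g n s"]) simp
    qed (use le[OF that] \<open>b < c\<close> in simp)
    then have sub: "path_image (apply_bcontfun l) \<subseteq> C" by (auto simp: path_image_def)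
    have "(\<lambda>n. g n 0) = (\<lambda>n. g n 1)" using g S_loop by auto
    then have "l 0 = l 1" using pt[of 0] pt[of 1] LIMSEQ_unique by metis
    with S_near[OF _ sub] obtain e where e: "0 < e"
      "\<And>h :: real \<Rightarrow>\<^sub>C 'a. apply_bcontfun h 0 = apply_bcontfun h 1 \<Longrightarrow> dist l h < e \<Longrightarrow> homotopic_loops C l (apply_bcontfun h)" by blast
    obtain n where "dist (g n) l < e" using metric_LIMSEQ_D[OF l e(1)] by blast
    then have "homotopic_loops C l (g n)" using e(2) g S_loop by (simp add: dist_commute)
    then have "l \<in> S" using g homotopic_loops_trans homotopic_loops_sym unfolding S_def by blast
    then show "l \<in> {g \<in> S. ?\<Phi> g \<le> b}" using le max_le_iff by blast
  qed

  \<comment> \<open>The minimax level and a Palais-Smale sequence there\<close>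
  obtain g0 where g0: "g0 \<in> S"
  proof -
    obtain h :: "real \<Rightarrow>\<^sub>C 'a" where "\<And>s. s \<in> {0..1} \<Longrightarrow> h s = \<gamma> s"
      using bcontfun_extends_path loop unfolding loop_in_def by blast
    then have "homotopic_loops C \<gamma> h"
      using loop unfolding loop_in_def by (intro homotopic_loops_eq) auto
    then show thesis using that by (simp add: S_def)
  qed
  define d where "d = Inf (?\<Phi> ` S)"
  have bdd: "bdd_below (?\<Phi> ` S)" using \<Phi>_nonneg by (rule bdd_belowI2)
  have d_le: "d \<le> ?\<Phi> g" if "g \<in> S" for g unfolding d_def by (rule cINF_lower[OF bdd that])
  have "0 \<le> d" unfolding d_def using g0 \<Phi>_nonneg by (intro cINF_greatest) auto
  have "d < c" using d_le[OF g0] \<Phi>_less[OF g0] by simp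
  have "\<exists>y s. y \<in> S \<and> ?\<Phi> y < d + k \<and> s \<in> {0..1} \<and> f (y s) = ?\<Phi> y \<and> norm (grad f (y s)) \<le> k"
    if k: "0 < k" for k
  proof -
    obtain g where g: "g \<in> S" "?\<Phi> g < d + k"
      using cINF_less_iff[OF _ bdd, of "d + k"] g0 k unfolding d_def by auto
    obtain y where y: "y \<in> S" "?\<Phi> y \<le> ?\<Phi> g"
      "\<And>z. z \<in> S \<Longrightarrow> z \<noteq> y \<Longrightarrow> ?\<Phi> y < ?\<Phi> z + k * dist y z"
    proof (rule ekeland_variational_principle[OF g(1), of d ?\<Phi> k])
      show "closed {x \<in> S. ?\<Phi> x \<le> b}" if "b \<le> ?\<Phi> g" for b
        using that \<Phi>_less[OF g(1)] by (intro closed_sublevel) simp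
    qed (use d_le k in auto)
    obtain e where e: "0 < e"
      "\<And>h :: real \<Rightarrow>\<^sub>C 'a. apply_bcontfun h 0 = apply_bcontfun h 1 \<Longrightarrow> dist y h < e \<Longrightarrow> homotopic_loops C y (apply_bcontfun h)"
      using S_near[OF S_loop S_sub] y(1) by blast
    obtain s where "s \<in> {0..1}" "f (y s) = ?\<Phi> y" "norm (grad f (y s)) \<le> k"
    \<comment> \<open>Ekeland's inequality compares \<open>y\<close> only with loops in
      \<open>S\<close>; the radius \<open>e\<close> guarantees that all competitors lie
      there.\<close>
    proof (rule almost_critical_point_on_loop[OF gd contG S_loop[OF y(1)] k e(1)])
      fix z :: "real \<Rightarrow>\<^sub>C 'a" assume "z 0 = z 1" "dist y z < e"
      then have "z \<in> S" using e(2) y(1) homotopic_loops_trans unfolding S_def by blast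
      then show "?\<Phi> y \<le> ?\<Phi> z + k * dist y z" using y(3)[of z] by (cases "z = y") auto
    qed
    then show ?thesis using y g by force
  qed
  then have "\<forall>n. \<exists>y s. y \<in> S \<and> ?\<Phi> y < d + inverse (real (Suc n)) \<and> s \<in> {0..1} \<and>
      f (y s) = ?\<Phi> y \<and> norm (grad f (y s)) \<le> inverse (real (Suc n))"
    by simp
  then obtain y s where ys: "\<And>n. y n \<in> S" "\<And>n. ?\<Phi> (y n) < d + inverse (real (Suc n))"
      "\<And>n. s n \<in> {0..1}" "\<And>n. f (y n (s n)) = ?\<Phi> (y n)"
      "\<And>n. norm (grad f (y n (s n))) \<le> inverse (real (Suc n))"
    by metis
  define p where "p n = y n (s n)" for n
  have flim: "(\<lambda>n. f (p n)) \<longlonglongrightarrow> d"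
  proof (rule tendsto_sandwich[OF _ _ tendsto_const LIMSEQ_inverse_real_of_nat_add])
    show "\<forall>\<^sub>F n in sequentially. d \<le> f (p n)" using d_le ys(1,4) by (simp add: p_def)
    show "\<forall>\<^sub>F n in sequentially. f (p n) \<le> d + inverse (real (Suc n))"
      using ys(2,4) by (simp add: p_def less_imp_le)
  qed
  have glim: "(\<lambda>n. grad f (p n)) \<longlonglongrightarrow> 0"
    using ys(5) by (intro Lim_null_comparison[OF _ LIMSEQ_inverse_real_of_nat]) (simp add: p_def)
  obtain r x where r: "strict_mono r" and lim: "(p \<circ> r) \<longlonglongrightarrow> x"
    using assms(5) \<open>0 \<le> d\<close> \<open>d < c\<close> flim glim
    unfolding PS_condition_def PS_sequence_def convergent_def by blast
  have "(\<lambda>n. f (p (r n))) \<longlonglongrightarrow> f x" "(\<lambda>n. grad f (p (r n))) \<longlonglongrightarrow> grad f x"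
    using continuous_on_tendsto_compose[OF contf lim] continuous_on_tendsto_compose[OF contG lim]
    by (simp_all add: o_def)
  with LIMSEQ_subseq_LIMSEQ[OF flim r] LIMSEQ_subseq_LIMSEQ[OF glim r]
  have fx: "f x = d" and gx: "grad f x = 0"
    using LIMSEQ_unique by (auto simp: o_def)
  have "x \<in> C"
  proof (rule limit_in_C)
    have "(p \<circ> r) n \<in> C" for n using ys(1,3) S_sub by (fastforce simp: p_def path_image_def)
    then show "x \<in> closure C"
      unfolding closure_sequential using lim by (intro exI[of _ "p \<circ> r"]) simp
  qed (simp add: fx \<open>d < c\<close>)
  \<comment> \<open>The maximum points \<open>p (r n)\<close> approach \<open>x\<close> while their
    values approach \<open>f x\<close>, so some loop enters the ball with its entire image below the
    barrier \<open>b\<close>.\<close>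
  have "\<not> strict_local_minimizer f x"
  proof
    assume "strict_local_minimizer f x"
    then obtain \<rho> b where \<rho>: "0 < \<rho>" "ball x \<rho> \<subseteq> C" and b: "f x < b"
      "\<And>z. z \<in> frontier (ball x \<rho>) \<Longrightarrow> b \<le> f z"
      using strict_local_minimizer_barrier openC \<open>x \<in> C\<close> by blast
    have "\<forall>\<^sub>F n in sequentially. dist ((p \<circ> r) n) x < \<rho>" by (rule tendstoD[OF lim \<rho>(1)])
    moreover have "\<forall>\<^sub>F n in sequentially. f (p (r n)) < b"
      using order_tendstoD(2)[OF LIMSEQ_subseq_LIMSEQ[OF flim r]] b(1) fx by (simp add: o_def)
    ultimately have "\<forall>\<^sub>F n in sequentially. dist (p (r n)) x < \<rho> \<and> f (p (r n)) < b"
      by eventually_elim simp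
    then obtain n where n: "dist (p (r n)) x < \<rho>" "f (p (r n)) < b"
      using eventually_happens'[OF sequentially_bot] by blast
    let ?y = "y (r n)"
    have "homotopic_loops C ?y (linepath x x)"
    proof (rule loop_in_ball_contractible[OF _ _ \<rho>(2) ys(3)[of "r n"] _ _ b(2)])
      \<comment> \<open>\<open>p (r n)\<close> is a maximum point of its loop, so a bound there is a
        bound on the whole loop.\<close>
      show "f (?y t) < b" if "t \<in> {0..1}" for t
        using max_upper[OF that, of ?y] n(2) ys(4)[of "r n"] by (simp add: p_def)
    qed (use S_path S_loop ys(1) n(1) in
        \<open>auto simp: p_def dist_commute pathstart_def pathfinish_def\<close>)
    then have "homotopic_loops C \<gamma> (linepath x x)"
      using ys(1) homotopic_loops_trans unfolding S_def by blast
    then show False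
      using not_contractible contractible_loop_iff[OF loop] \<open>x \<in> C\<close> by blast
  qed
  then show ?thesis using \<open>x \<in> C\<close> gx unfolding critical_point_def by blast
qed

end
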